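(* There is a unimodular lattice $L$ in dimension $44$ having minimum norm $4$ with $\sigma(L)=20$.
   Context: A (Euclidean) lattice $L \subset \mathbb{R}^n$ in dimension $n$ (i.e. of full rank $n$) is unimodular if $L=L^*$, where $L^*=\{x\in\mathbb{R}^n \mid (x,y)\in\mathbb{Z}\text{ for all }y\in L\}$ and $(x,y)$ is the standard inner product. The norm of a vector $x$ is $(x,x)$ (the squared length), and the minimum norm $\min(L)$ is the smallest norm of a nonzero vector of $L$. A unimodular lattice is even if all its vectors have even norm, and odd otherwise; even unimodular lattices exist only in dimensions divisible by $8$, so a unimodular lattice in dimension $44$ is odd. For an odd unimodular lattice $L$, the even sublattice is $L_0=\{x\in L\mid (x,x)\in 2\mathbb{Z}\}$, the shadow is $S(L)=L_0^*\setminus L$, and $\sigma(L)=4\min(S(L))$, where $\min(S(L))$ is the minimum norm of a vector in $S(L)$. *)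

theory Defs
  imports "HOL-Analysis.Analysis"
begin

text \<open>
  Throughout, the \<^emph>\<open>norm\<close> of a vector is the lattice-theoretic one, \<open>x \<bullet> x\<close>
  (the squared length), not the library's \<open>norm x\<close>.
\<close>

definition full_rank_lattice :: "'a::euclidean_space set \<Rightarrow> bool" where
  "full_rank_lattice L \<longleftrightarrow>
     (\<exists>B. independent B \<and> span B = UNIV \<and>
          L = {\<Sum>b\<in>B. of_int (c b) *\<^sub>R b | c :: 'a \<Rightarrow> int. True})"

definition dual_lattice :: "'a::euclidean_space set \<Rightarrow> 'a set" where
  "dual_lattice L = {x. \<forall>y\<in>L. x \<bullet> y \<in> \<int>}"

definition unimodular :: "'a::euclidean_space set \<Rightarrow> bool" where
  "unimodular L \<longleftrightarrow> full_rank_lattice L \<and> L = dual_lattice L"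

text \<open>
  The minimum need not exist for arbitrary sets, but it is attained for the nonzero
  vectors of a lattice and for the shadow of an odd unimodular lattice.
\<close>

definition least_norm :: "'a::euclidean_space set \<Rightarrow> real" where
  "least_norm S = (LEAST r. \<exists>x\<in>S. r = x \<bullet> x)"

definition min_norm :: "'a::euclidean_space set \<Rightarrow> real" where
  "min_norm L = least_norm (L - {0})"

definition even_sublattice :: "'a::euclidean_space set \<Rightarrow> 'a set" where
  "even_sublattice L = {x \<in> L. \<exists>k::int. x \<bullet> x = 2 * of_int k}"

text \<open>
  The shadow and \<open>\<sigma>\<close> are meant for odd unimodular lattices. If \<open>L\<close> is even
  unimodular, then \<open>even_sublattice L = L\<close> and the shadow is empty, so \<open>\<sigma>\<close> is
  unspecified; this does not arise in dimensions not divisible by 8.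
\<close>

definition shadow :: "'a::euclidean_space set \<Rightarrow> 'a set" where
  "shadow L = dual_lattice (even_sublattice L) - L"

definition shadow_sigma :: "'a::euclidean_space set \<Rightarrow> real" where
  "shadow_sigma L = 4 * least_norm (shadow L)"

end

theory Submission
  imports Defs
begin

text \<open>
  The lattice is obtained by Construction A from a self-dual code over \<open>\<int>/4\<close>: it consists of
  the vectors \<open>y/2\<close> with \<open>y\<close> integral and \<open>y mod 4\<close> in the code. The residue code
  (the reduction modulo 2) is a doubly-even binary code of length 44 and dimension 10 with nonzero
  weights 16, 20, 24, 28, whose dual has minimum weight at least 4.

  If \<open>y\<close> has a nonzero residue, it has at least 16 odd entries, so \<open>y/2\<close> has norm
  at least 4. Otherwise \<open>y/2\<close> is integral and reduces to a word of the dual of the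
  residue code, so again its norm is at least 4.

  The shadow is \<open>s + L\<close>, where \<open>2s\<close> is a characteristic vector of the lattice.
  Doubling a shadow vector gives an integral vector whose odd entries form the
  complement of a word of the residue code, hence number at least 44 - 28 = 16, and the norm of
  the shadow vector is at least 4. Norms in the shadow are congruent to the norm of \<open>s\<close>
  modulo 2. Choosing \<open>s\<close> of norm 5 makes 5 the minimum.
\<close>

subsection \<open>Unimodular lattices and their shadows\<close>

text \<open>Integral products among the \<open>B i\<close> put the lattice inside its dual. The
  coefficients of \<open>D j\<close> in the basis \<open>B\<close> are the products
  \<open>D j \<bullet> D k\<close>, so their integrality puts the \<open>D j\<close>, which generate
  the dual, inside the lattice.\<close>

lemma unimodular_if_dual_basis:
  fixes B D :: "nat \<Rightarrow> 'a::euclidean_space"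
  assumes BD: "\<And>i j. i < DIM('a) \<Longrightarrow> j < DIM('a) \<Longrightarrow> B i \<bullet> D j = (if i = j then 1 else 0)"
    and BB: "\<And>i j. i < DIM('a) \<Longrightarrow> j < DIM('a) \<Longrightarrow> B i \<bullet> B j \<in> \<int>"
    and DD: "\<And>i j. i < DIM('a) \<Longrightarrow> j < DIM('a) \<Longrightarrow> D i \<bullet> D j \<in> \<int>"
  shows "unimodular {\<Sum>i<DIM('a). of_int (c i) *\<^sub>R B i | c :: nat \<Rightarrow> int. True}"
    (is "unimodular ?L")
proof -
  let ?n = "DIM('a)"
  have coeff: "(\<Sum>i<?n. u i *\<^sub>R B i) \<bullet> D j = u j" if "j < ?n" for u j
    using that by (simp add: inner_sum_left BD if_distrib cong: if_cong)
  have inj: "inj_on B {..<?n}"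
    by (rule inj_onI) (metis BD lessThan_iff zero_neq_one)
  have sum_image: "(\<Sum>b\<in>B ` {..<?n}. u b *\<^sub>R b) = (\<Sum>i<?n. u (B i) *\<^sub>R B i)" for u
    by (simp add: sum.reindex[OF inj])
  have indep: "independent (B ` {..<?n})"
  proof (rule independent_if_scalars_zero)
    fix u b assume "(\<Sum>b\<in>B ` {..<?n}. u b *\<^sub>R b) = 0" "b \<in> B ` {..<?n}"
    then obtain j where "j < ?n" "b = B j" "(\<Sum>i<?n. u (B i) *\<^sub>R B i) = 0"
      unfolding sum_image by auto
    then show "u b = 0" using coeff[of j "\<lambda>i. u (B i)"] by simp
  qed simp
  have span: "span (B ` {..<?n}) = UNIV"
    using indep inj
    by (metis card_image card_lessThan dim_eq_full indep_card_eq_dim_span dim_span)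
  have lattice: "?L = {\<Sum>b\<in>B ` {..<?n}. of_int (c b) *\<^sub>R b | c :: 'a \<Rightarrow> int. True}"
  proof (intro set_eqI iffI; clarsimp)
    fix c :: "nat \<Rightarrow> int"
    have "(\<Sum>i<?n. of_int (c i) *\<^sub>R B i) =
        (\<Sum>b\<in>B ` {..<?n}. of_int (c (inv_into {..<?n} B b)) *\<^sub>R b)"
      by (simp add: sum.reindex[OF inj] inv_into_f_f[OF inj])
    then show "\<exists>c'. (\<Sum>i<?n. of_int (c i) *\<^sub>R B i) = (\<Sum>b\<in>B ` {..<?n}. of_int (c' b) *\<^sub>R b)"
      by (rule exI[of _ "\<lambda>b. c (inv_into {..<?n} B b)"])
  next
    fix c :: "'a \<Rightarrow> int"
    show "\<exists>c'. (\<Sum>b\<in>B ` {..<?n}. of_int (c b) *\<^sub>R b) = (\<Sum>i<?n. of_int (c' i) *\<^sub>R B i)"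
      by (auto simp: sum.reindex[OF inj] intro!: exI[of _ "\<lambda>i. c (B i)"])
  qed
  have expand: "x = (\<Sum>j<?n. (x \<bullet> D j) *\<^sub>R B j)" for x
  proof -
    have "x \<in> span (B ` {..<?n})" by (simp add: span)
    then obtain u where "x = (\<Sum>b\<in>B ` {..<?n}. u b *\<^sub>R b)"
      by (auto simp: span_finite)
    then have x: "x = (\<Sum>i<?n. u (B i) *\<^sub>R B i)" by (simp add: sum_image)
    show ?thesis
      by (subst x, rule sum.cong) (use coeff[of _ "\<lambda>i. u (B i)"] x in auto)
  qed
  have "?L \<subseteq> dual_lattice ?L"
    by (auto simp: dual_lattice_def inner_sum_left inner_sum_right intro!: Ints_sum Ints_mult BB)
  moreover have "dual_lattice ?L \<subseteq> ?L"
  proof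
    fix x assume x: "x \<in> dual_lattice ?L"
    have xB: "x \<bullet> B k \<in> \<int>" if "k < ?n" for k
    proof -
      have "(\<Sum>i<?n. of_int (if i = k then 1 else 0) *\<^sub>R B i) = B k"
        using that by (simp add: if_distrib[of "\<lambda>c. of_int c *\<^sub>R _"] cong: if_cong)
      then have "B k \<in> ?L"
        by (intro CollectI exI[of _ "\<lambda>i. if i = k then 1 else 0"]) simp
      then show ?thesis using x by (auto simp: dual_lattice_def)
    qed
    have "x \<bullet> D j \<in> \<int>" if "j < ?n" for j
    proof -
      have "x \<bullet> D j = x \<bullet> (\<Sum>k<?n. (D j \<bullet> D k) *\<^sub>R B k)" using expand[of "D j"] by simp
      also have "\<dots> = (\<Sum>k<?n. (D j \<bullet> D k) * (x \<bullet> B k))" by (simp add: inner_sum_right)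
      also have "\<dots> \<in> \<int>" using that by (intro Ints_sum Ints_mult DD xB) auto
      finally show ?thesis .
    qed
    then have "\<forall>j<?n. \<exists>m::int. x \<bullet> D j = of_int m" by (meson Ints_cases)
    then obtain c :: "nat \<Rightarrow> int" where "\<And>j. j < ?n \<Longrightarrow> x \<bullet> D j = of_int (c j)" by metis
    then have "x = (\<Sum>j<?n. of_int (c j) *\<^sub>R B j)" using expand[of x] by simp
    then show "x \<in> ?L" by blast
  qed
  moreover have "full_rank_lattice ?L"
    unfolding full_rank_lattice_def using indep span lattice by blast
  ultimately show ?thesis unfolding unimodular_def by blast
qed

lemma least_norm_eqI:
  assumes "x \<in> S" "x \<bullet> x = r" "\<And>y. y \<in> S \<Longrightarrow> r \<le> y \<bullet> y"
  shows "least_norm S = r"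
  unfolding least_norm_def using assms by (intro Least_equality) auto

lemma unimodular_inner_Ints: "unimodular L \<Longrightarrow> x \<in> L \<Longrightarrow> y \<in> L \<Longrightarrow> x \<bullet> y \<in> \<int>"
  by (auto simp: unimodular_def dual_lattice_def)

lemma unimodular_diff:
  assumes "unimodular L" "x \<in> L" "y \<in> L"
  shows "x - y \<in> L"
proof -
  have L: "L = dual_lattice L" using assms by (simp add: unimodular_def)
  have "x - y \<in> dual_lattice L"
    using unimodular_inner_Ints[OF assms(1)] assms(2,3)
    by (auto simp: dual_lattice_def inner_diff_left intro: Ints_diff)
  with L show ?thesis by simp
qed

definition even_int :: "real \<Rightarrow> bool" where
  "even_int r \<longleftrightarrow> (\<exists>k::int. r = 2 * of_int k)"

lemma even_int_of_int [simp]: "even_int (of_int k) \<longleftrightarrow> even k"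
proof -
  have "real_of_int k = 2 * of_int m \<longleftrightarrow> k = 2 * m" for m
    by (metis of_int_eq_iff of_int_mult of_int_numeral)
  then show ?thesis by (auto simp: even_int_def elim: evenE)
qed

text \<open>The first condition on \<open>s\<close> says that \<open>2s\<close> is a characteristic vector of \<open>L\<close>.\<close>

lemma shadow_characteristic:
  assumes L: "unimodular L"
    and s: "\<And>y. y \<in> L \<Longrightarrow> even_int (2 * (s \<bullet> y) - y \<bullet> y)"
    and odd: "\<not> even_int (s \<bullet> s)"
  shows "s \<in> shadow L" and "t \<in> shadow L \<Longrightarrow> t - s \<in> L"
proof -
  note int = unimodular_inner_Ints[OF L]
  have dual: "x \<in> L \<longleftrightarrow> (\<forall>y\<in>L. x \<bullet> y \<in> \<int>)" for x
    using L by (auto simp: unimodular_def dual_lattice_def)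
  have L0: "even_sublattice L = {y \<in> L. even_int (y \<bullet> y)}"
    by (simp add: even_sublattice_def even_int_def)
  \<comment> \<open>Taking \<open>y = s\<close> in the characteristic condition would make
    \<open>s \<bullet> s\<close> even.\<close>
  have "s \<notin> L" using s[of s] odd by auto
  moreover have "s \<bullet> y \<in> \<int>" if "y \<in> even_sublattice L" for y
  proof -
    from that obtain k m :: int where "y \<bullet> y = 2 * of_int k" "2 * (s \<bullet> y) - y \<bullet> y = 2 * of_int m"
      using s[of y] by (auto simp: L0 even_int_def)
    then have "s \<bullet> y = of_int (k + m)" by simp
    then show ?thesis by (metis Ints_of_int)
  qed
  ultimately show "s \<in> shadow L" by (simp add: shadow_def dual_lattice_def)
  assume "t \<in> shadow L"
  then have t0: "\<And>y. y \<in> even_sublattice L \<Longrightarrow> t \<bullet> y \<in> \<int>" and "t \<notin> L"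
    by (auto simp: shadow_def dual_lattice_def)
  \<comment> \<open>This \<open>z\<close> has odd norm, and \<open>t \<bullet> z\<close> lies in 1/2
    + Z because \<open>z + z\<close> is in the even sublattice. Any \<open>y\<close> of odd norm
    differs from \<open>z\<close> by a vector of even norm, so \<open>t \<bullet> y\<close> lies in
    1/2 + Z as well, and so does \<open>s \<bullet> y\<close> by the characteristic
    condition.\<close>
  then obtain z where z: "z \<in> L" "t \<bullet> z \<notin> \<int>" using dual[of t] by blast
  show "t - s \<in> L" unfolding dual[of "t - s"]
  proof
    fix y assume y: "y \<in> L"
    show "(t - s) \<bullet> y \<in> \<int>"
    proof (cases "y \<in> even_sublattice L")
      case True
      then show ?thesis
        using t0 \<open>\<And>y. y \<in> even_sublattice L \<Longrightarrow> s \<bullet> y \<in> \<int>\<close> by (simp add: inner_diff_left)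
    next
      case False
      obtain a b c where abc: "y \<bullet> y = of_int a" "z \<bullet> z = of_int b" "y \<bullet> z = of_int c"
        using int y z by (meson Ints_cases)
      have "odd a" using False y abc by (auto simp: L0)
      have "odd b" using z(1,2) t0[of z] abc by (auto simp: L0)
      have "(y - z) \<bullet> (y - z) = of_int (a + b - 2 * c)"
        using abc by (simp add: inner_diff_left inner_diff_right inner_commute)
      then have "y - z \<in> even_sublattice L"
        using \<open>odd a\<close> \<open>odd b\<close> unimodular_diff[OF L y z(1)]
        by (simp add: L0 del: of_int_add of_int_diff of_int_mult)
      then obtain d where d: "t \<bullet> y - t \<bullet> z = of_int d"
        using t0 by (metis Ints_cases inner_diff_right)
      have "0 \<in> L" using dual[of 0] by simp
      then have "z + z \<in> L" using unimodular_diff[OF L z(1) unimodular_diff[OF L _ z(1)], of 0]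
        by simp
      moreover have "(z + z) \<bullet> (z + z) = of_int (4 * b)"
        using abc by (simp add: inner_add_left inner_add_right)
      ultimately have "z + z \<in> even_sublattice L" by (simp add: L0 del: of_int_mult)
      then obtain e where e: "2 * (t \<bullet> z) = of_int e"
        using t0 by (metis Ints_cases inner_add_right mult_2)
      have "odd e"
      proof
        assume "even e"
        then obtain e' where "e = 2 * e'" by blast
        then have "t \<bullet> z = of_int e'" using e by simp
        then show False using z by simp
      qed
      obtain m :: int where "2 * (s \<bullet> y) - y \<bullet> y = 2 * of_int m"
        using s[OF y] by (auto simp: even_int_def)
      then have s2: "2 * (s \<bullet> y) = of_int (a + 2 * m)" using abc by simp
      have "even (e - a)" using \<open>odd e\<close> \<open>odd a\<close> by simp
      then obtain f where "e - a = 2 * f" by blast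
      then have "real_of_int e = of_int a + 2 * of_int f"
        by (metis add.commute diff_add_cancel of_int_add of_int_mult of_int_numeral)
      then have "(t - s) \<bullet> y = of_int (d + f - m)"
        using d e s2 by (simp add: inner_diff_left)
      then show ?thesis by (metis Ints_of_int)
    qed
  qed
qed

subsection \<open>The code\<close>

text \<open>
  Modulo 2 these are the last 34 columns of a systematic generator matrix of the quasi-cyclic code
  generated by the simultaneous cyclic shifts of the four blocks \<open>x\<^sup>2 + x\<^sup>4 + x\<^sup>8 + x\<^sup>9\<close>,
  \<open>1 + x + x\<^sup>3 + x\<^sup>5\<close>, \<open>1 + x\<^sup>5 + x\<^sup>6 + x\<^sup>9\<close>, \<open>x\<^sup>3 + x\<^sup>5 + x\<^sup>6 + x\<^sup>8\<close> modulo \<open>x^11 - 1\<close>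
  (coordinates permuted). The last ten columns are lifted so that the rows have inner products
  divisible by 4.
\<close>

definition glue_rows :: "int list list" where
  "glue_rows =
   [[1, 0, 0, 1, 1, 1, 0, 0, 0, 0, 0, 1, 1, 1, 1, 1, 1, 0, 0, 1, 1, 0, 1, 0, 1, 0, 0, 0, 1, 0, 1, 1, 1, 1],
    [1, 1, 0, 1, 0, 0, 1, 0, 0, 0, 0, 1, 0, 0, 0, 0, 0, 1, 0, 1, 0, 1, 1, 1, 1, 1, 0, 0, 1, 1, 1, 0, 0, 0],
    [1, 1, 1, 1, 0, 1, 0, 1, 0, 0, 0, 1, 0, 1, 1, 1, 1, 0, 1, 1, 0, 0, 0, 0, 0, 1, 1, 0, 1, 1, 0, 0, 1, 1],
    [1, 1, 1, 0, 0, 1, 1, 0, 1, 0, 0, 1, 1, 1, 0, 0, 0, 1, 0, 0, 0, 0, 1, 1, -1, 2, 1, 1, 1, 1, 2, -1, 1, 0],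
    [1, 1, 1, 0, 1, 1, 1, 1, 0, 1, 0, 1, 0, 0, 0, 1, 1, 0, 1, 1, 1, 0, 1, 0, 2, 1, 2, 1, 0, 1, 2, 1, 2, 0],
    [1, 1, 1, 0, 1, 0, 1, 1, 1, 0, 1, 1, 0, 1, 1, 1, 0, 1, 0, 0, 0, 1, 1, 0, -1, 0, 1, 2, 0, 0, 2, 1, 0, -1],
    [1, 1, 1, 0, 1, 0, 0, 1, 1, 1, 0, 0, 0, 1, 0, 0, 0, 0, 1, 1, 1, 0, 0, 1, 1, -1, 2, -1, 1, 2, 1, -1, 2, -1],
    [1, 0, 1, 0, 1, 0, 0, 0, 1, 1, 1, 1, 1, 1, 0, 1, 1, 0, 0, 0, 0, 1, 1, 1, 0, 1, 1, 0, 0, -1, -1, 0, 0, 1],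
    [1, 1, 0, 0, 1, 0, 0, 0, 0, 1, 1, 0, 0, 0, 0, 1, 0, 1, 0, 1, 1, 0, 0, 1, 2, 2, 1, -1, -1, 0, 0, 0, -1, -1],
    [1, 0, 1, 1, 1, 0, 0, 0, 0, 0, 1, 0, 1, 1, 1, 1, 0, 0, 1, 1, 0, 1, 1, 1, 0, 2, 0, 1, 2, 1, 1, 1, 1, 2]]"

text \<open>
  Together with the residue code, the vectors whose middle 24 entries are the \<open>j\<close>-th unit vector and
  whose last ten are \<open>check_rows ! j\<close> span the dual of the residue code.
\<close>

definition check_rows :: "int list list" where
  "check_rows =
   [[1, 0, 0, 1, 0, 1, 1, 1, 1, 1],
    [0, 1, 0, 0, 1, 1, 0, 1, 0, 0],
    [0, 0, 1, 0, 0, 1, 1, 0, 1, 0],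
    [0, 0, 0, 1, 0, 0, 1, 1, 0, 1],
    [1, 1, 1, 1, 0, 1, 1, 0, 0, 1],
    [1, 0, 0, 0, 0, 1, 0, 0, 1, 1],
    [1, 0, 1, 1, 1, 1, 0, 1, 1, 0],
    [0, 1, 0, 1, 1, 1, 1, 0, 1, 1],
    [1, 1, 0, 1, 0, 0, 0, 0, 1, 0],
    [0, 1, 1, 0, 1, 0, 0, 0, 0, 1],
    [1, 1, 0, 0, 1, 0, 1, 1, 1, 1],
    [1, 0, 0, 1, 1, 0, 1, 0, 0, 0],
    [1, 1, 0, 0, 1, 1, 0, 0, 0, 1],
    [1, 0, 0, 1, 1, 0, 0, 1, 1, 1],
    [1, 0, 1, 1, 0, 0, 1, 1, 0, 0],
    [0, 1, 0, 1, 1, 0, 0, 1, 1, 0],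
    [0, 0, 1, 0, 1, 1, 0, 0, 1, 1],
    [1, 1, 1, 0, 1, 0, 0, 1, 1, 0],
    [0, 1, 1, 1, 0, 1, 0, 0, 1, 1],
    [1, 1, 0, 0, 0, 1, 0, 1, 1, 0],
    [0, 1, 1, 0, 0, 0, 1, 0, 1, 1],
    [1, 1, 0, 0, 1, 1, 1, 0, 1, 0],
    [0, 1, 1, 0, 0, 1, 1, 1, 0, 1],
    [1, 1, 1, 1, 1, 1, 1, 1, 1, 1]]"

text \<open>Its entries are odd exactly off a word of weight 24 of the residue code.\<close>

definition char_vec :: "int list" where
  "char_vec =
    [-1, 0, 0, 1, 0, 1, 1, 1, -1, 1, 0, 0, -1, 1, 0, 1, 1, 1, 1, 0, 1, 0,
     1, 0, 0, 1, 1, 0, 1, 0, 0, 0, 1, 0, 0, 0, 0, 0, 1, 0, 0, 0, 0, 0]"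

definition unit_list :: "nat \<Rightarrow> nat \<Rightarrow> int \<Rightarrow> int list" where
  "unit_list n i c = map (\<lambda>j. if i = j then c else 0) [0..<n]"

text \<open>The matrix is upper triangular with diagonal entries 1, 2, 4 occurring 10, 24, 10 times.
  Its determinant 2^44 becomes 1 when all 44 rows are halved.\<close>

definition basis_rows :: "int list list" where
  "basis_rows =
     map (\<lambda>i. unit_list 10 i 1 @ glue_rows ! i) [0..<10] @
     map (\<lambda>j. unit_list 34 (10 + j) 2 @ map ((*) 2) (check_rows ! j)) [0..<24] @
     map (\<lambda>k. unit_list 44 (34 + k) 4) [0..<10]"

text \<open>As matrices, this is 4 times the inverse transpose of \<open>basis_rows\<close>.\<close>

definition dual_rows :: "int list list" where
  "dual_rows =
     map (\<lambda>i. unit_list 44 i 4) [0..<10] @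
     map (\<lambda>j. map (\<lambda>i. - 2 * glue_rows ! i ! j) [0..<10] @ unit_list 34 j 2) [0..<24] @
     map (\<lambda>k. map (\<lambda>i. (\<Sum>j\<leftarrow>[0..<24]. glue_rows ! i ! j * check_rows ! j ! k)
                      - glue_rows ! i ! (24 + k)) [0..<10] @
              map (\<lambda>j. - check_rows ! j ! k) [0..<24] @ unit_list 10 k 1) [0..<10]"

text \<open>Skipping zero entries keeps the simplifier-based evaluations below fast.\<close>

fun dot :: "int list \<Rightarrow> int list \<Rightarrow> int" where
  "dot (x # xs) (y # ys) = (if x = 0 then dot xs ys else x * y + dot xs ys)"
| "dot _ _ = 0"

text \<open>Rows that vanish modulo 2 are skipped: 34 of the 44 basis rows do, so the list has 2^10
  entries rather than 2^44.\<close>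

fun binary_span :: "nat \<Rightarrow> bool list list \<Rightarrow> bool list list" where
  "binary_span n [] = [replicate n False]"
| "binary_span n (r # rs) =
     (let S = binary_span n rs in if True \<in> set r then map (map2 (\<noteq>) r) S @ S else S)"

definition weight :: "bool list \<Rightarrow> nat" where
  "weight w = length (filter id w)"

section \<open>Checks of the matrices and the code by evaluation\<close>

lemma dot_basis_dual:
  "map (\<lambda>b. map (dot b) dual_rows) basis_rows = map (\<lambda>i. unit_list 44 i 4) [0..<44]"
  by code_simp

text \<open>Halving both vectors divides inner products by 4, so divisibility by 4 here means
  integrality in the lattice, and by 8 in \<open>dot_char_vec\<close> means evenness.\<close>

lemma dot_basis_basis: "\<forall>b\<in>set basis_rows. \<forall>c\<in>set basis_rows. 4 dvd dot b c"
  by code_simp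

lemma dot_dual_dual: "\<forall>b\<in>set dual_rows. \<forall>c\<in>set dual_rows. 4 dvd dot b c"
  by code_simp

lemma dot_char_vec: "\<forall>b\<in>set basis_rows. 8 dvd 2 * dot char_vec b - dot b b"
  by code_simp

lemma dot_char_vec_self: "dot char_vec char_vec = 20"
  by code_simp

text \<open>The 1024 residue words are enumerated. The second bound concerns the coset of the
  parities of \<open>char_vec\<close>, which contains the parities of all doubled shadow
  vectors.\<close>

lemma weight_binary_span:
  "\<forall>w\<in>set (binary_span 44 (map (map odd) basis_rows)).
     (w = replicate 44 False \<or> 16 \<le> weight w) \<and> 16 \<le> weight (map2 (\<noteq>) (map odd char_vec) w)"
  by code_simp

text \<open>A word is orthogonal to the residue code exactly when the columns at its support sum to
  zero, so dual weight at least 4 is a statement about sums of at most three columns.\<close>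

definition residue_columns :: "bool list list" where
  "residue_columns = map (\<lambda>k. map (\<lambda>r. odd (r ! k)) (take 10 basis_rows)) [0..<44]"

lemma distinct_residue_columns: "distinct residue_columns"
  by code_simp

text \<open>The case \<open>u = v\<close> also rules out a zero column.\<close>

lemma residue_columns_sum_free:
  "\<forall>u\<in>set residue_columns. \<forall>v\<in>set residue_columns. map2 (\<noteq>) u v \<notin> set residue_columns"
  by code_simp

subsection \<open>The lattice\<close>

lemma dot_eq_sum: "length xs = n \<Longrightarrow> length ys = n \<Longrightarrow> dot xs ys = (\<Sum>k<n. xs ! k * ys ! k)"
proof (induction xs ys arbitrary: n rule: dot.induct)
  case (1 x xs y ys)
  then show ?case by (cases n) (simp_all add: sum.lessThan_Suc_shift del: sum.lessThan_Suc)
qed auto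

lemma length_basis_rows: "length basis_rows = 44" "\<forall>r\<in>set basis_rows. length r = 44"
  by code_simp+

lemma length_dual_rows: "length dual_rows = 44" "\<forall>r\<in>set dual_rows. length r = 44"
  by code_simp+

lemma length_char_vec: "length char_vec = 44"
  by code_simp

text \<open>Modulo 2, a row with odd coefficient is added and one with even coefficient dropped; a
  row that is zero modulo 2 can always be dropped, which matches the skip in
  \<open>binary_span\<close>.\<close>

lemma map_odd_combination_in_binary_span:
  fixes M :: "int list list"
  assumes "\<forall>r\<in>set M. length r = n"
  shows "map (\<lambda>k. odd (\<Sum>i<length M. c i * M ! i ! k)) [0..<n] \<in> set (binary_span n (map (map odd) M))"
  using assms
proof (induction M arbitrary: c)
  case Nil
  then show ?case by (simp add: map_replicate_const)
next
  case (Cons r M)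
  define w where "w = map (\<lambda>k. odd (\<Sum>i<length M. c (Suc i) * M ! i ! k)) [0..<n]"
  define S where "S = binary_span n (map (map odd) M)"
  have w: "w \<in> set S" unfolding w_def S_def using Cons.prems by (intro Cons.IH) auto
  have r: "length r = n" using Cons.prems by simp
  let ?v = "map (\<lambda>k. odd (\<Sum>i<length (r # M). c i * (r # M) ! i ! k)) [0..<n]"
  have v: "?v = map (\<lambda>k. odd (c 0 * r ! k + (\<Sum>i<length M. c (Suc i) * M ! i ! k))) [0..<n]"
    by (simp add: sum.lessThan_Suc_shift del: sum.lessThan_Suc)
  show ?case
  proof (cases "odd (c 0) \<and> True \<in> set (map odd r)")
    case True
    then have "?v = map2 (\<noteq>) (map odd r) w"
      unfolding v by (auto simp: list_eq_iff_nth_eq w_def r)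
    then show ?thesis using w True by (auto simp: S_def Let_def)
  next
    case False
    then have "even (c 0 * r ! k)" if "k < n" for k
      using that r nth_mem[of k r] by force
    then have "?v = w" unfolding v by (auto simp: w_def)
    then show ?thesis using w by (auto simp: S_def Let_def)
  qed
qed

lemma weight_le_sum_squares:
  fixes y :: "nat \<Rightarrow> int"
  shows "int (weight (map (\<lambda>k. odd (y k)) [0..<n])) \<le> (\<Sum>k<n. (y k)\<^sup>2)"
proof (induction n)
  case (Suc n)
  have "1 \<le> (y n)\<^sup>2" if "odd (y n)"
  proof -
    have "y n \<noteq> 0" using that by auto
    then have "0 < (y n)\<^sup>2" by simp
    then show ?thesis by linarith
  qed
  then show ?case using Suc by (auto simp: weight_def add_increasing2)
qed (simp add: weight_def)

text \<open>Vectors are indexed by the type \<open>44\<close>, matrix rows by list positions. Any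
  bijection serves, since inner products do not depend on the order of coordinates.\<close>

definition coord :: "44 \<Rightarrow> nat" where
  "coord = (SOME e. bij_betw e UNIV {..<44})"

lemma bij_coord: "bij_betw coord UNIV {..<44}"
proof -
  have "\<exists>e :: 44 \<Rightarrow> nat. bij_betw e UNIV {..<44}"
    using ex_bij_betw_finite_nat[of "UNIV :: 44 set"] by (simp add: atLeast0LessThan)
  then show ?thesis unfolding coord_def by (rule someI_ex)
qed

text \<open>Only the values of \<open>y\<close> below 44 matter, so \<open>(!) xs\<close> can be
  passed for a list of length 44.\<close>

definition half_vec :: "(nat \<Rightarrow> int) \<Rightarrow> real ^ 44" where
  "half_vec y = (\<chi> i. of_int (y (coord i)) / 2)"

lemma inner_half_vec: "half_vec y \<bullet> half_vec z = of_int (\<Sum>k<44. y k * z k) / 4"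
proof -
  have "half_vec y \<bullet> half_vec z = (\<Sum>i\<in>UNIV. of_int (y (coord i) * z (coord i)) / 4)"
    by (simp add: inner_vec_def half_vec_def)
  also have "\<dots> = (\<Sum>k<44. of_int (y k * z k) / 4)"
    by (rule sum.reindex_bij_betw[OF bij_coord])
  finally show ?thesis by (simp add: sum_divide_distrib)
qed

lemma inner_half_vec_nth:
  "length xs = 44 \<Longrightarrow> length ys = 44 \<Longrightarrow> half_vec ((!) xs) \<bullet> half_vec ((!) ys) = of_int (dot xs ys) / 4"
  by (simp add: inner_half_vec dot_eq_sum)

lemma half_vec_add: "half_vec y + half_vec z = half_vec (\<lambda>k. y k + z k)"
  by (simp add: half_vec_def vec_eq_iff add_divide_distrib)

lemma half_vec_sum:
  "(\<Sum>i\<in>I. of_int (c i) *\<^sub>R half_vec (y i)) = half_vec (\<lambda>k. \<Sum>i\<in>I. c i * y i k)"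
  by (simp add: half_vec_def vec_eq_iff sum_divide_distrib)

lemma half_vec_eq_0: "(\<And>k. k < 44 \<Longrightarrow> y k = 0) \<Longrightarrow> half_vec y = 0"
  using bij_coord by (auto simp: half_vec_def vec_eq_iff bij_betw_def)

section \<open>The lattice and its unimodularity\<close>

definition basis_vec :: "nat \<Rightarrow> real ^ 44" where
  "basis_vec i = half_vec ((!) (basis_rows ! i))"

definition lattice44 :: "(real ^ 44) set" where
  "lattice44 = {\<Sum>i<44. of_int (c i) *\<^sub>R basis_vec i | c :: nat \<Rightarrow> int. True}"

lemma quarter_Ints: "4 dvd k \<Longrightarrow> of_int k / 4 \<in> (\<int> :: real set)"
  by (auto elim!: dvdE)

lemma unimodular_lattice44: "unimodular lattice44"
proof -
  define D where "D i = half_vec ((!) (dual_rows ! i))" for i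
  note len = length_basis_rows length_dual_rows
  have "unimodular {\<Sum>i<DIM(real ^ 44). of_int (c i) *\<^sub>R basis_vec i | c :: nat \<Rightarrow> int. True}"
  proof (rule unimodular_if_dual_basis[where D = D])
    fix i j assume "i < DIM(real ^ 44)" "j < DIM(real ^ 44)"
    then have ij: "i < 44" "j < 44" by simp_all
    have "dot (basis_rows ! i) (dual_rows ! j) = unit_list 44 i 4 ! j"
      using arg_cong[OF dot_basis_dual, of "\<lambda>M. M ! i ! j"] ij by (simp add: len)
    also have "\<dots> = (if i = j then 4 else 0)"
      using ij by (simp add: unit_list_def)
    finally have dot: "dot (basis_rows ! i) (dual_rows ! j) = (if i = j then 4 else 0)" .
    then show "basis_vec i \<bullet> D j = (if i = j then 1 else 0)"
      using ij len by (simp add: basis_vec_def D_def inner_half_vec_nth)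
    show "basis_vec i \<bullet> basis_vec j \<in> \<int>"
      using ij len dot_basis_basis by (simp add: basis_vec_def inner_half_vec_nth quarter_Ints)
    show "D i \<bullet> D j \<in> \<int>"
      using ij len dot_dual_dual by (simp add: D_def inner_half_vec_nth quarter_Ints)
  qed
  then show ?thesis by (simp add: lattice44_def)
qed

lemma basis_vec_in_lattice44: "i < 44 \<Longrightarrow> basis_vec i \<in> lattice44"
  unfolding lattice44_def
  by (intro CollectI exI[of _ "\<lambda>j. if j = i then 1 else 0"])
     (simp add: if_distrib[of "\<lambda>c. of_int c *\<^sub>R _"] cong: if_cong)

section \<open>Parities of the entries and the minimum norm\<close>

lemma lattice44_cases:
  assumes "x \<in> lattice44"
  obtains y where "x = half_vec y"
    "map (\<lambda>k. odd (y k)) [0..<44] \<in> set (binary_span 44 (map (map odd) basis_rows))"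
proof -
  from assms obtain c :: "nat \<Rightarrow> int" where x: "x = (\<Sum>i<44. of_int (c i) *\<^sub>R basis_vec i)"
    by (auto simp: lattice44_def)
  show thesis
  proof
    show "x = half_vec (\<lambda>k. \<Sum>i<44. c i * basis_rows ! i ! k)"
      by (simp only: x basis_vec_def half_vec_sum)
    show "map (\<lambda>k. odd (\<Sum>i<44. c i * basis_rows ! i ! k)) [0..<44]
        \<in> set (binary_span 44 (map (map odd) basis_rows))"
      using map_odd_combination_in_binary_span[of basis_rows 44 c] length_basis_rows by simp
  qed
qed

text \<open>If all ten sums were even, the one, two or three residue columns at \<open>T\<close>
  would sum to zero.\<close>

lemma no_light_dual_word:
  assumes T: "T \<subseteq> {..<44}" "T \<noteq> {}" "card T \<le> 3"
  shows "\<exists>i<10. odd (\<Sum>k\<in>T. basis_rows ! i ! k)"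
proof (rule ccontr)
  define col where "col k = map (\<lambda>r. odd (r ! k)) (take 10 basis_rows)" for k
  assume "\<not> ?thesis"
  then have ev: "even (\<Sum>k\<in>T. basis_rows ! i ! k)" if "i < 10" for i using that by blast
  have residue_columns: "residue_columns = map col [0..<44]" by (simp add: residue_columns_def col_def)
  have len: "length (col k) = 10" for k by (simp add: col_def length_basis_rows)
  have nth: "col k ! i = odd (basis_rows ! i ! k)" if "i < 10" for i k
    using that by (simp add: col_def length_basis_rows)
  have inj: "col a \<noteq> col b" if "a < 44" "b < 44" "a \<noteq> b" for a b
    using distinct_residue_columns that by (auto simp: residue_columns distinct_conv_nth)
  have mem: "col a \<in> set residue_columns" if "a < 44" for a using that
    by (simp add: residue_columns del: upt_rec_numeral)
  have free: "map2 (\<noteq>) (col a) (col b) \<noteq> col d" if "a < 44" "b < 44" "d < 44" for a b d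
    using residue_columns_sum_free that by (metis mem)
  have fin: "finite T" using T(1) finite_subset by blast
  then have "card T \<noteq> 0" using T(2) by simp
  then consider "card T = 1" | "card T = 2" | "card T = 3" using T(3) by linarith
  then show False
  proof cases
    case 1
    then obtain a where "T = {a}" by (auto simp: card_1_singleton_iff)
    \<comment> \<open>With equal arguments, \<open>free\<close> says that the column is
      nonzero.\<close>
    then show False using ev T(1) free[of a a a] by (auto simp: list_eq_iff_nth_eq len nth)
  next
    case 2
    then obtain a b where "T = {a, b}" "a \<noteq> b" by (auto simp: card_2_iff)
    then show False using ev T(1) inj[of a b] by (auto simp: list_eq_iff_nth_eq len nth)
  next
    case 3
    then obtain a b d where "T = {a, b, d}" "a \<noteq> b" "a \<noteq> d" "b \<noteq> d" by (auto simp: card_3_iff)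
    then show False using ev T(1) free[of a b d] by (auto simp: list_eq_iff_nth_eq len nth)
  qed
qed

lemma lattice44_norm_ge_4:
  assumes x: "x \<in> lattice44" "x \<noteq> 0"
  shows "4 \<le> x \<bullet> x"
proof -
  obtain y where y: "x = half_vec y"
    and word: "map (\<lambda>k. odd (y k)) [0..<44] \<in> set (binary_span 44 (map (map odd) basis_rows))"
    using lattice44_cases[OF x(1)] by blast
  have xx: "x \<bullet> x = of_int (\<Sum>k<44. (y k)\<^sup>2) / 4"
    by (simp add: y inner_half_vec power2_eq_square)
  have "16 \<le> (\<Sum>k<44. (y k)\<^sup>2)"
  proof (cases "map (\<lambda>k. odd (y k)) [0..<44] = replicate 44 False")
    case False
    then have "16 \<le> weight (map (\<lambda>k. odd (y k)) [0..<44])"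
      using weight_binary_span word by blast
    then show ?thesis using weight_le_sum_squares[of y 44] by linarith
  next
    case True
    then have "even (y k)" if "k < 44" for k
      using that by (auto simp: list_eq_iff_nth_eq simp del: upt_rec_numeral)
    moreover define z where "z k = y k div 2" for k
    ultimately have y2: "y k = 2 * z k" if "k < 44" for k using that by (simp add: z_def)
    have sum_y: "(\<Sum>k<44. (y k)\<^sup>2) = 4 * (\<Sum>k<44. (z k)\<^sup>2)"
      by (simp add: y2 power_mult_distrib sum_distrib_left)
    \<comment> \<open>Here \<open>x\<close> has the integral entries \<open>z\<close>, and its norm
      is the sum of their squares.\<close>
    have "\<not> (\<Sum>k<44. (z k)\<^sup>2) \<le> 3"
    proof
      assume small: "(\<Sum>k<44. (z k)\<^sup>2) \<le> 3"
      define T where "T = {k \<in> {..<44}. odd (z k)}"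
      \<comment> \<open>A nonzero even entry alone would contribute at least 4, so \<open>z\<close>
        is supported on \<open>T\<close>.\<close>
      have zero: "z k = 0" if "k < 44" "even (z k)" for k
      proof (rule ccontr)
        assume "z k \<noteq> 0"
        with that obtain m where "z k = 2 * m" "m \<noteq> 0" by auto
        then have "4 \<le> (z k)\<^sup>2" by (simp add: power_mult_distrib) (smt (verit) zero_less_power2)
        also have "\<dots> \<le> (\<Sum>k<44. (z k)\<^sup>2)"
          using that by (intro member_le_sum) auto
        finally show False using small by simp
      qed
      have "int (card T) = (\<Sum>k\<in>T. 1)" by simp
      also have "\<dots> \<le> (\<Sum>k\<in>T. (z k)\<^sup>2)"
      proof (rule sum_mono)
        fix k assume "k \<in> T"
        then have "z k \<noteq> 0" by (auto simp: T_def)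
        then show "1 \<le> (z k)\<^sup>2" using zero_less_power2[of "z k"] by linarith
      qed
      also have "\<dots> \<le> (\<Sum>k<44. (z k)\<^sup>2)"
        by (rule sum_mono2) (auto simp: T_def)
      finally have "card T \<le> 3" using small by simp
      moreover have "T \<noteq> {}"
      proof
        assume "T = {}"
        then have "y k = 0" if "k < 44" for k using zero y2 that by (auto simp: T_def)
        then show False using x(2) y half_vec_eq_0 by blast
      qed
      ultimately obtain i where i: "i < 10" "odd (\<Sum>k\<in>T. basis_rows ! i ! k)"
        using no_light_dual_word[of T] by (auto simp: T_def)
      \<comment> \<open>Since \<open>y = 2z\<close>, integrality of this product makes
        \<open>z\<close> orthogonal modulo 2 to row \<open>i\<close>.\<close>
      have "x \<bullet> basis_vec i \<in> \<int>"
        using i x(1) unimodular_lattice44 basis_vec_in_lattice44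
        by (intro unimodular_inner_Ints) auto
      then obtain m where "x \<bullet> basis_vec i = of_int m" by (elim Ints_cases)
      moreover have "x \<bullet> basis_vec i = of_int (\<Sum>k<44. z k * basis_rows ! i ! k) / 2"
        by (simp add: y basis_vec_def inner_half_vec y2 mult.assoc flip: sum_distrib_left)
      ultimately have "real_of_int (\<Sum>k<44. z k * basis_rows ! i ! k) = of_int (2 * m)" by simp
      then have "even (\<Sum>k<44. z k * basis_rows ! i ! k)"
        by (metis dvd_triv_left of_int_eq_iff)
      also have "(\<Sum>k<44. z k * basis_rows ! i ! k) = (\<Sum>k\<in>T. z k * basis_rows ! i ! k)"
        using zero by (intro sum.mono_neutral_right) (auto simp: T_def)
      \<comment> \<open>Modulo 2 each odd \<open>z k\<close> can be replaced by 1.\<close>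
      also have "\<dots> = (\<Sum>k\<in>T. (z k - 1) * basis_rows ! i ! k) + (\<Sum>k\<in>T. basis_rows ! i ! k)"
        by (simp add: algebra_simps flip: sum.distrib)
      finally have "even (\<Sum>k\<in>T. (z k - 1) * basis_rows ! i ! k)
          \<longleftrightarrow> even (\<Sum>k\<in>T. basis_rows ! i ! k)" by simp
      moreover have "even (\<Sum>k\<in>T. (z k - 1) * basis_rows ! i ! k)"
        by (rule dvd_sum) (auto simp: T_def)
      ultimately show False using i(2) by blast
    qed
    then show ?thesis unfolding sum_y by simp
  qed
  then have "real_of_int 16 \<le> of_int (\<Sum>k<44. (y k)\<^sup>2)" by (rule of_int_le_iff[THEN iffD2])
  then show ?thesis unfolding xx by simp
qed

section \<open>The characteristic vector and the minimum of the shadow\<close>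

definition shadow_vec :: "real ^ 44" where
  "shadow_vec = half_vec ((!) char_vec)"

lemma shadow_vec_self: "shadow_vec \<bullet> shadow_vec = 5"
  by (simp add: shadow_vec_def inner_half_vec_nth length_char_vec dot_char_vec_self)

lemma even_int_add: "even_int a \<Longrightarrow> even_int b \<Longrightarrow> even_int (a + b)"
  unfolding even_int_def by (metis distrib_left of_int_add)

lemma even_int_mult: "even_int a \<Longrightarrow> even_int (of_int k * a)"
  unfolding even_int_def by (metis mult.left_commute of_int_mult)

text \<open>The function is quadratic, but modulo 2 it is additive on an integral lattice, so the
  check on the basis suffices.\<close>

lemma shadow_vec_characteristic:
  assumes "y \<in> lattice44"
  shows "even_int (2 * (shadow_vec \<bullet> y) - y \<bullet> y)"
proof -
  let ?f = "\<lambda>y. 2 * (shadow_vec \<bullet> y) - y \<bullet> y"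
  have basis: "even_int (?f (basis_vec i))" if i: "i < 44" for i
  proof -
    have "8 dvd 2 * dot char_vec (basis_rows ! i) - dot (basis_rows ! i) (basis_rows ! i)"
      using dot_char_vec i length_basis_rows by simp
    then obtain m where "2 * dot char_vec (basis_rows ! i) - dot (basis_rows ! i) (basis_rows ! i) = 8 * m"
      by blast
    then have "real_of_int (2 * dot char_vec (basis_rows ! i) - dot (basis_rows ! i) (basis_rows ! i)) = of_int (8 * m)"
      by simp
    then have "?f (basis_vec i) = 2 * of_int m"
      using i length_basis_rows length_char_vec
      by (simp add: shadow_vec_def basis_vec_def inner_half_vec_nth field_simps)
    then show ?thesis by (auto simp: even_int_def)
  qed
  obtain c :: "nat \<Rightarrow> int" where c: "y = (\<Sum>i<44. of_int (c i) *\<^sub>R basis_vec i)"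
    using assms by (auto simp: lattice44_def)
  note int = unimodular_inner_Ints[OF unimodular_lattice44 basis_vec_in_lattice44 basis_vec_in_lattice44]
  have "even_int (?f (\<Sum>i<n. of_int (c i) *\<^sub>R basis_vec i))" if "n \<le> 44" for n
    using that
  proof (induction n)
    case 0
    then show ?case by (simp add: even_int_def)
  next
    case (Suc n)
    define u b where "u = (\<Sum>i<n. of_int (c i) *\<^sub>R basis_vec i)" and "b = basis_vec n"
    obtain m where m: "b \<bullet> b = of_int m" using int[of n n] Suc.prems by (auto simp: b_def elim: Ints_cases)
    have "u \<bullet> b \<in> \<int>"
      unfolding u_def b_def inner_sum_left inner_scaleR_left using Suc.prems
      by (intro Ints_sum Ints_mult Ints_of_int int) auto
    then obtain p where p: "u \<bullet> b = of_int p" by (elim Ints_cases)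
    then have p': "b \<bullet> u = of_int p" by (simp add: inner_commute)
    \<comment> \<open>The last term is the deviation from additivity; it is even because
      \<open>c n\<close> and its square have the same parity.\<close>
    have "?f (u + of_int (c n) *\<^sub>R b)
        = ?f u + of_int (c n) * ?f b + of_int ((c n - c n * c n) * m - 2 * c n * p)"
      unfolding inner_add_left inner_add_right inner_scaleR_left inner_scaleR_right m p p'
      by (simp add: algebra_simps)
    moreover have "even_int (?f u)" using Suc by (simp add: u_def)
    moreover have "even_int (of_int (c n) * ?f b)"
      using Suc.prems basis[of n] by (simp add: b_def even_int_mult)
    moreover have "even_int (of_int ((c n - c n * c n) * m - 2 * c n * p))"
      unfolding even_int_of_int by simp
    ultimately have "even_int (?f (u + of_int (c n) *\<^sub>R b))" by (simp only: even_int_add)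
    then show ?case by (simp add: u_def b_def)
  qed
  then show ?thesis unfolding c by blast
qed

text \<open>Counting odd entries gives only 4; the characteristic property makes the norm an odd
  integer, which raises the bound to 5.\<close>

lemma shadow_norm_ge_5:
  assumes u: "u \<in> lattice44"
  shows "5 \<le> (shadow_vec + u) \<bullet> (shadow_vec + u)"
proof -
  obtain y where y: "u = half_vec y"
    and word: "map (\<lambda>k. odd (y k)) [0..<44] \<in> set (binary_span 44 (map (map odd) basis_rows))"
    using lattice44_cases[OF u] by blast
  let ?w = "\<lambda>k. char_vec ! k + y k"
  have "map (\<lambda>k. odd (?w k)) [0..<44] = map2 (\<noteq>) (map odd char_vec) (map (\<lambda>k. odd (y k)) [0..<44])"
    by (auto simp: list_eq_iff_nth_eq length_char_vec simp del: upt_rec_numeral)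
  then have "16 \<le> weight (map (\<lambda>k. odd (?w k)) [0..<44])"
    using weight_binary_span word by simp
  then have "16 \<le> (\<Sum>k<44. (?w k)\<^sup>2)" using weight_le_sum_squares[of ?w 44] by linarith
  then have "real_of_int 16 \<le> of_int (\<Sum>k<44. (?w k)\<^sup>2)" by (rule of_int_le_iff[THEN iffD2])
  moreover have "(shadow_vec + u) \<bullet> (shadow_vec + u) = of_int (\<Sum>k<44. (?w k)\<^sup>2) / 4"
    by (simp add: shadow_vec_def y half_vec_add inner_half_vec power2_eq_square)
  ultimately have ge: "4 \<le> (shadow_vec + u) \<bullet> (shadow_vec + u)" by simp
  obtain m where m: "u \<bullet> u = of_int m"
    using unimodular_inner_Ints[OF unimodular_lattice44 u u] by (elim Ints_cases)
  obtain k :: int where k: "2 * (shadow_vec \<bullet> u) - u \<bullet> u = 2 * of_int k"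
    using shadow_vec_characteristic[OF u] by (auto simp: even_int_def)
  have eq: "(shadow_vec + u) \<bullet> (shadow_vec + u) = of_int (5 + 2 * (k + m))"
    using shadow_vec_self k m
    by (simp add: inner_add_left inner_add_right inner_commute[of u shadow_vec])
  then have "4 \<le> 5 + 2 * (k + m)" using ge by linarith
  then have "5 \<le> 5 + 2 * (k + m)" by presburger
  then show ?thesis unfolding eq by linarith
qed

theorem proposition4p6:
  "\<exists>L :: (real ^ 44) set. unimodular L \<and> min_norm L = 4 \<and> shadow_sigma L = 20"
proof (intro exI conjI)
  show "unimodular lattice44" by (rule unimodular_lattice44)
  \<comment> \<open>Row 43 is 4 times a unit vector, so its half attains norm 4.\<close>
  have "dot (basis_rows ! 43) (basis_rows ! 43) = 16" by code_simp
  then have b: "basis_vec 43 \<bullet> basis_vec 43 = 4"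
    using length_basis_rows by (simp add: basis_vec_def inner_half_vec_nth)
  show "min_norm lattice44 = 4" unfolding min_norm_def
  proof (rule least_norm_eqI)
    show "basis_vec 43 \<in> lattice44 - {0}" using b basis_vec_in_lattice44[of 43] by auto
  qed (use b lattice44_norm_ge_4 in auto)
  have "\<not> even_int (shadow_vec \<bullet> shadow_vec)"
    using even_int_of_int[of 5] by (simp add: shadow_vec_self del: even_int_of_int)
  note shadow = shadow_characteristic[OF unimodular_lattice44 shadow_vec_characteristic this]
  have "least_norm (shadow lattice44) = 5"
  proof (rule least_norm_eqI)
    show "shadow_vec \<in> shadow lattice44" by (rule shadow(1))
    show "shadow_vec \<bullet> shadow_vec = 5" by (rule shadow_vec_self)
    fix t assume "t \<in> shadow lattice44"
    then show "5 \<le> t \<bullet> t" using shadow_norm_ge_5[OF shadow(2)] by simp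
  qed
  then show "shadow_sigma lattice44 = 20" by (simp add: shadow_sigma_def)
qed

end
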